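(* Let $x\in[0,1]$. For any sequences of integers $N_k\geq 5$ and $l_k$ with $0\le l_k\le N_k-1$, $N_k\to\infty$ and $l_k/N_k\to x$, we have \[ \lim_{k\to\infty}\frac{h_{N_k}(0,l_k)}{N_k^2}=\frac{2}{5}x(1-x), \] where $h_N(0,l)$ is the expected hitting time from vertex $0$ to vertex $l$ of the simple random walk on $C_N^2$.
   Context: $C_N^2$ is the graph with vertex set $\mathbb{Z}_N$ in which $u,v$ are adjacent iff $u-v\in\{\pm1,\pm2\}$ mod $N$. The simple random walk moves from a vertex to each of its neighbours with probability $1/\deg$; the hitting time from $p$ to $q$ is the number of steps until the walk from $p$ first reaches $q$. *)

theory Defs
  imports "HOL-Probability.Probability" "HOL-Number_Theory.Cong"
begin

section \<open>Simple random walk on a graph\<close>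

text \<open>A graph is given by its adjacency relation \<open>E\<close>.  The step distribution
  \<open>pmf_of_set\<close> is meaningful at vertices of finite non-zero degree.\<close>

definition neighbours :: "('a \<Rightarrow> 'a \<Rightarrow> bool) \<Rightarrow> 'a \<Rightarrow> 'a set" where
  "neighbours E u = {v. E u v}"

definition srw_step :: "('a \<Rightarrow> 'a \<Rightarrow> bool) \<Rightarrow> 'a \<Rightarrow> 'a pmf" where
  "srw_step E u = pmf_of_set (neighbours E u)"

text \<open>Law of the \<open>n\<close>-th position given the positions \<open>\<omega> 0, \<dots>, \<omega> (n - 1)\<close>.\<close>

definition srw_kernel :: "('a \<Rightarrow> 'a \<Rightarrow> bool) \<Rightarrow> 'a \<Rightarrow> nat \<Rightarrow> (nat \<Rightarrow> 'a) \<Rightarrow> 'a measure" where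
  "srw_kernel E p n \<omega> =
     measure_pmf (case n of 0 \<Rightarrow> return_pmf p | Suc m \<Rightarrow> srw_step E (\<omega> m))"

interpretation SRW: Ionescu_Tulcea "srw_kernel E p" "\<lambda>_. count_space UNIV" for E p
proof (rule Ionescu_Tulcea.intro)
  fix i
  show "srw_kernel E p i \<in>
      measurable (PiM {0..<i} (\<lambda>_. count_space UNIV)) (subprob_algebra (count_space UNIV))"
  proof (cases i)
    case 0
    then show ?thesis
      by (auto simp: srw_kernel_def[abs_def] measure_pmf_in_subprob_algebra)
  next
    case (Suc m)
    have "(\<lambda>\<omega>. \<omega> m) \<in> measurable (PiM {0..<i} (\<lambda>_. count_space UNIV)) (count_space UNIV)"
      using Suc by (intro measurable_component_singleton) auto
    moreover have "(\<lambda>u. measure_pmf (srw_step E u)) \<in>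
        measurable (count_space UNIV) (subprob_algebra (count_space UNIV))"
      by (auto simp: measure_pmf_in_subprob_algebra)
    ultimately show ?thesis
      unfolding srw_kernel_def[abs_def] Suc by (simp add: measurable_compose)
  qed
qed (simp add: srw_kernel_def measure_pmf.prob_space_axioms)

text \<open>Law, on the space of trajectories, of the simple random walk started at \<open>p\<close>
  (Ionescu-Tulcea extension of the kernels above).\<close>

definition srw :: "('a \<Rightarrow> 'a \<Rightarrow> bool) \<Rightarrow> 'a \<Rightarrow> (nat \<Rightarrow> 'a) measure" where
  "srw E p = SRW.PF.lim E p"

lemma sets_srw: "sets (srw E p) = sets (PiM UNIV (\<lambda>_. count_space UNIV))"
  by (simp add: srw_def)

lemma prob_space_srw: "prob_space (srw E p)"
proof -
  interpret J: prob_space "SRW.CI E p {}"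
    by (rule SRW.PF.prob_space_P) simp_all
  have "distr (srw E p) (PiM {} (\<lambda>_. count_space UNIV)) (\<lambda>x. restrict x {}) = SRW.CI E p {}"
    unfolding srw_def by (rule SRW.distr_lim) simp
  then have distr: "prob_space (distr (srw E p) (PiM {} (\<lambda>_. count_space UNIV)) (\<lambda>x. restrict x {}))"
    using J.prob_space_axioms by simp
  have "(\<lambda>x. restrict x {}) \<in> measurable (srw E p) (PiM {} (\<lambda>_. count_space UNIV))"
    unfolding measurable_cong_sets[OF sets_srw refl] by (rule measurable_restrict) simp
  from prob_space_distrD[OF this distr] show ?thesis .
qed

lemma emeasure_srw_cylinder:
  "emeasure (srw E p) {\<omega>. \<forall>i\<le>n. \<omega> i = w i} =
     indicator {p} (w 0) * (\<Prod>i<n. ennreal (pmf (srw_step E (w i)) (w (Suc i))))"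
proof -
  let ?M = "\<lambda>_::nat. count_space (UNIV::'a set)"
  define S where "S n = {restrict w {0..<n}}" for n
  define q where "q n = emeasure (SRW.C E p 0 n (\<lambda>_. undefined)) (S n)" for n
  have S_PiE: "S n = PiE {0..<n} (\<lambda>i. {w i})" for n
    by (auto simp: S_def PiE_singleton[OF restrict_extensional] PiE_def Pi_def extensional_def fun_eq_iff)
  have S[measurable]: "S n \<in> sets (PiM {0..<n} ?M)" for n
    unfolding S_PiE by (intro sets_PiM_I_finite) auto
  have und: "(\<lambda>_. undefined) \<in> space (PiM {0..<0} ?M)"
    by (simp add: space_PiM)
  have q_Suc: "q (Suc n) = q n * emeasure (srw_kernel E p n w) {w n}" for n
  proof -
    have "q (Suc n) = (\<integral>\<^sup>+x. emeasure (SRW.eP E p (0 + n) x) (S (Suc n)) \<partial>SRW.C E p 0 n (\<lambda>_. undefined))"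
      unfolding q_def SRW.C.simps
    proof (rule emeasure_bind[OF _ _ S])
      show "space (SRW.C E p 0 n (\<lambda>_. undefined)) \<noteq> {}"
        by (rule prob_space.not_empty[OF SRW.prob_space_C[OF und]])
      have sets_C: "sets (SRW.C E p 0 n (\<lambda>_. undefined)) = sets (PiM {0..<n} ?M)"
        using SRW.sets_C[OF und, of E p n] by simp
      show "SRW.eP E p (0 + n) \<in> measurable (SRW.C E p 0 n (\<lambda>_. undefined))
          (subprob_algebra (PiM {0..<Suc n} ?M))"
        unfolding measurable_cong_sets[OF sets_C refl] add_0 by (rule SRW.measurable_eP)
    qed
    also have "\<dots> = (\<integral>\<^sup>+x. emeasure (srw_kernel E p n w) {w n} * indicator (S n) x
        \<partial>SRW.C E p 0 n (\<lambda>_. undefined))"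
    proof (rule nn_integral_cong)
      fix x assume "x \<in> space (SRW.C E p 0 n (\<lambda>_. undefined))"
      then have x: "x \<in> space (PiM {0..<n} ?M)"
        using SRW.space_C[OF und, of E p n] by simp
      have ext: "x \<in> extensional {0..<n}"
        using x by (simp add: space_PiM PiE_def)
      have eq: "fun_upd x n y = restrict w {0..<Suc n} \<longleftrightarrow> x = restrict w {0..<n} \<and> y = w n" for y
      proof
        assume *: "fun_upd x n y = restrict w {0..<Suc n}"
        have "x i = restrict w {0..<n} i" for i
          using fun_cong[OF *, of i] extensional_arb[OF ext, of n] by (cases "i = n") auto
        with fun_cong[OF *, of n] show "x = restrict w {0..<n} \<and> y = w n"
          by auto
      next
        assume *: "x = restrict w {0..<n} \<and> y = w n"
        have "(fun_upd x n y) i = restrict w {0..<Suc n} i" for i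
          using * by (cases "i = n") auto
        then show "fun_upd x n y = restrict w {0..<Suc n}"
          by blast
      qed
      have "emeasure (SRW.eP E p n x) (S (Suc n)) =
          emeasure (srw_kernel E p n x) ((\<lambda>y. fun_upd x n y) -` S (Suc n) \<inter> UNIV)"
        using SRW.emeasure_eP[OF x S, of E p] by simp
      also have "(\<lambda>y. fun_upd x n y) -` S (Suc n) \<inter> UNIV =
          (if x \<in> S n then {w n} else {})"
        by (simp only: S_def vimage_def singleton_iff eq Int_UNIV_right) auto
      also have "emeasure (srw_kernel E p n x) \<dots> =
          emeasure (srw_kernel E p n w) {w n} * indicator (S n) x"
        by (cases n) (auto simp: S_def srw_kernel_def split: split_indicator)
      finally show "emeasure (SRW.eP E p (0 + n) x) (S (Suc n)) =
          emeasure (srw_kernel E p n w) {w n} * indicator (S n) x" by simp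
    qed
    also have "\<dots> = emeasure (srw_kernel E p n w) {w n} * q n"
      unfolding q_def
      by (subst nn_integral_cmult_indicator) (use SRW.sets_C[OF und, of E p n] S in auto)
    finally show ?thesis by (simp add: mult.commute)
  qed
  have q0: "q 0 = 1"
    unfolding q_def SRW.C.simps emeasure_return[OF S] by (simp add: S_def restrict_def)
  have q: "q (Suc n) =
      indicator {p} (w 0) * (\<Prod>i<n. ennreal (pmf (srw_step E (w i)) (w (Suc i))))" for n
  proof (induction n)
    case 0
    show ?case
      by (simp add: q_Suc q0 srw_kernel_def emeasure_pmf_single indicator_def)
  next
    case (Suc n)
    then show ?case
      by (subst q_Suc) (simp add: srw_kernel_def emeasure_pmf_single mult.assoc)
  qed
  have cyl: "{\<omega>. \<forall>i\<le>n. \<omega> i = w i} = SRW.PF.emb UNIV {0..<Suc n} (S (Suc n))"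
  proof (rule set_eqI)
    fix \<omega>
    have "(\<forall>i\<le>n. \<omega> i = w i) \<longleftrightarrow> restrict \<omega> {0..<Suc n} = restrict w {0..<Suc n}"
      by (metis atLeast0LessThan lessThan_iff less_Suc_eq_le restrict_apply' restrict_ext)
    then show "\<omega> \<in> {\<omega>. \<forall>i\<le>n. \<omega> i = w i} \<longleftrightarrow> \<omega> \<in> SRW.PF.emb UNIV {0..<Suc n} (S (Suc n))"
      by (simp add: S_def prod_emb_iff del: restrict_apply)
  qed
  have "emeasure (srw E p) {\<omega>. \<forall>i\<le>n. \<omega> i = w i} = emeasure (SRW.CI E p {0..<Suc n}) (S (Suc n))"
    unfolding srw_def cyl by (rule SRW.lim) (simp_all add: S)
  also have "\<dots> = q (Suc n)"
    unfolding q_def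
    using SRW.emeasure_CI[OF order_refl S, of E p "Suc n"]
      prod_emb_id[OF sets.sets_into_space[OF S[of "Suc n"], unfolded space_PiM]]
    by (simp only:)
  finally show ?thesis
    by (simp only: q)
qed

text \<open>First time \<open>n \<ge> 0\<close> at which a trajectory is at \<open>q\<close>; it is \<open>\<infinity>\<close> if \<open>q\<close> is never visited
  (the infimum of the empty set), and \<open>0\<close> if the trajectory starts at \<open>q\<close>.\<close>

definition hitting_time :: "'a \<Rightarrow> (nat \<Rightarrow> 'a) \<Rightarrow> enat" where
  "hitting_time q \<omega> = (INF n\<in>{n. \<omega> n = q}. enat n)"

lemma measurable_hitting_time:
  "(\<lambda>\<omega>. ennreal_of_enat (hitting_time q \<omega>)) \<in> borel_measurable (srw E p)"
proof -
  have *: "hitting_time q = (\<lambda>\<omega>. INF n. if \<omega> n = q then enat n else \<infinity>)"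
  proof
    fix \<omega>
    show "hitting_time q \<omega> = (INF n. if \<omega> n = q then enat n else \<infinity>)"
      unfolding hitting_time_def
    proof (rule antisym)
      show "(INF n\<in>{n. \<omega> n = q}. enat n) \<le> (INF n. if \<omega> n = q then enat n else \<infinity>)"
        by (rule INF_greatest) (auto intro: INF_lower)
      show "(INF n. if \<omega> n = q then enat n else \<infinity>) \<le> (INF n\<in>{n. \<omega> n = q}. enat n)"
      proof (rule INF_greatest)
        fix n assume "n \<in> {n. \<omega> n = q}"
        then show "(INF n. if \<omega> n = q then enat n else \<infinity>) \<le> enat n"
          by (intro INF_lower2[of n]) auto
      qed
    qed
  qed
  have [measurable]: "(\<lambda>\<omega>. \<omega> n) \<in> measurable (srw E p) (count_space UNIV)" for n
    unfolding measurable_cong_sets[OF sets_srw refl]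
    by (rule measurable_component_singleton) simp
  show ?thesis
    unfolding * by measurable
qed

definition expected_hitting_time :: "('a \<Rightarrow> 'a \<Rightarrow> bool) \<Rightarrow> 'a \<Rightarrow> 'a \<Rightarrow> ennreal" where
  "expected_hitting_time E p q = (\<integral>\<^sup>+\<omega>. ennreal_of_enat (hitting_time q \<omega>) \<partial>srw E p)"


section \<open>The square of the cycle\<close>

text \<open>The vertex set \<open>\<int>/N\<close> is represented by the residues \<open>{0..<N}\<close>.\<close>

definition cycle_square :: "int \<Rightarrow> int \<Rightarrow> int \<Rightarrow> bool" where
  "cycle_square N u v \<longleftrightarrow>
     u \<in> {0..<N} \<and> v \<in> {0..<N} \<and> (\<exists>d\<in>{1, -1, 2, -2}. [u - v = d] (mod N))"

lemma card_neighbours_cycle_square: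
  assumes "N \<ge> 5" "u \<in> {0..<N}"
  shows "card (neighbours (cycle_square N) u) = 4"
proof -
  have eq: "neighbours (cycle_square N) u = (\<lambda>d. (u - d) mod N) ` {1, -1, 2, -2}"
  proof (intro set_eqI iffI)
    fix v assume "v \<in> neighbours (cycle_square N) u"
    then obtain d where d: "d \<in> {1, -1, 2, -2}" "[u - v = d] (mod N)" and v: "v \<in> {0..<N}"
      by (auto simp: neighbours_def cycle_square_def)
    from d(2) have "(u - d) mod N = v mod N"
      by (simp add: cong_def mod_eq_dvd_iff algebra_simps)
    with v d(1) show "v \<in> (\<lambda>d. (u - d) mod N) ` {1, -1, 2, -2}"
      by (intro image_eqI[of _ _ d]) auto
  next
    fix v assume "v \<in> (\<lambda>d. (u - d) mod N) ` {1, -1, 2, -2}"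
    then obtain d where d: "d \<in> {1, -1, 2, -2}" and v: "v = (u - d) mod N"
      by blast
    have "[u - v = d] (mod N)"
      unfolding v cong_def by (simp add: mod_diff_right_eq)
    with d assms v show "v \<in> neighbours (cycle_square N) u"
      by (auto simp: neighbours_def cycle_square_def)
  qed
  have "inj_on (\<lambda>d. (u - d) mod N) {1, -1, 2, -2}"
  proof (rule inj_onI)
    fix d e assume de: "d \<in> {1, -1, 2, -2}" "e \<in> {1, -1, 2, -2}"
      and "(u - d) mod N = (u - e) mod N"
    then have "N dvd e - d"
      by (simp add: mod_eq_dvd_iff)
    moreover have "\<bar>e - d\<bar> < N"
      using de assms(1) by auto
    ultimately show "d = e"
      using dvd_imp_le_int[of "e - d" N] assms(1) by fastforce
  qed
  then show ?thesis
    unfolding eq by (simp add: card_image del: image_insert)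
qed

definition h_sq :: "int \<Rightarrow> int \<Rightarrow> int \<Rightarrow> ennreal" where
  "h_sq N u v = expected_hitting_time (cycle_square N) u v"

end

(* The distance d from the target, written as an integer in {0..N}, makes 2/5 d (N - d) drop by
   exactly 1 on average along a step, except at d = 1 and d = N - 1, where wrapping around the cycle
   makes it too large by N/5.  So 2/5 d (N - d) is a subsolution of the equation for the expected
   hitting time.  Adding 4/5 N off the target turns it into a supersolution.  Optional stopping for
   the walk killed at the target gives 2/5 l (N - l) \<le> h_N(0,l) \<le> 2/5 l (N - l) + 4/5 N,
   and division by N^2 gives the limit. *)

theory Submission
  imports Defs
begin

section \<open>Hitting times through sub- and supersolutions\<close>

text \<open>Newest position first, so that \<open>hd\<close> is the current position. For a
  countable vertex type the histories form a countable type as well, so their laws are determined by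
  singletons.\<close>

primrec history :: "nat \<Rightarrow> (nat \<Rightarrow> 'a) \<Rightarrow> 'a list" where
  "history 0 \<omega> = [\<omega> 0]"
| "history (Suc n) \<omega> = \<omega> (Suc n) # history n \<omega>"

lemma hd_history [simp]: "hd (history n \<omega>) = \<omega> n"
  by (cases n) auto

lemma set_history: "set (history n \<omega>) = \<omega> ` {..n}"
  by (induction n) (auto simp: atMost_Suc)

lemma history_eq_iff: "history n \<omega> = history n w \<longleftrightarrow> (\<forall>i\<le>n. \<omega> i = w i)"
  by (induction n) (auto simp: le_Suc_eq)

lemma measurable_srw_component:
  "(\<lambda>\<omega>. \<omega> n) \<in> measurable (srw E p) (count_space UNIV)"
  unfolding measurable_cong_sets[OF sets_srw refl]
  by (rule measurable_component_singleton) simp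

text \<open>Countability handles the varying tail: for each fixed tail \<open>xs\<close>, prepending
  the next position is measurable, and only countably many tails occur.\<close>

lemma measurable_history:
  fixes E :: "'a::countable \<Rightarrow> 'a \<Rightarrow> bool"
  shows "history n \<in> measurable (srw E p) (count_space UNIV)"
proof (induction n)
  case 0
  have "(\<lambda>\<omega>. [\<omega> 0]) \<in> measurable (srw E p) (count_space UNIV)"
    by (rule measurable_compose[OF measurable_srw_component]) simp
  then show ?case
    by simp
next
  case (Suc n)
  have "(\<lambda>\<omega>. \<omega> (Suc n) # xs) \<in> measurable (srw E p) (count_space UNIV)" for xs
    by (rule measurable_compose[OF measurable_srw_component]) simp
  from measurable_compose_countable[OF this Suc] show ?case
    by simp
qed

text \<open>The discrete counterpart of the trajectory measure. It keeps the whole past because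
  having avoided the target is a property of the history, not of the current position.\<close>

primrec srw_path :: "('a \<Rightarrow> 'a \<Rightarrow> bool) \<Rightarrow> 'a \<Rightarrow> nat \<Rightarrow> 'a list pmf" where
  "srw_path E p 0 = return_pmf [p]"
| "srw_path E p (Suc n) =
     bind_pmf (srw_path E p n) (\<lambda>xs. map_pmf (\<lambda>v. v # xs) (srw_step E (hd xs)))"

text \<open>Here \<open>V\<close> is closed under steps. Taking \<open>V = UNIV\<close> shows that
  only genuine histories have mass; a smaller \<open>V\<close> confines later inequalities to actual
  vertices.\<close>

lemma set_srw_path:
  assumes "p \<in> V" "\<And>u. u \<in> V \<Longrightarrow> set_pmf (srw_step E u) \<subseteq> V"
    and "xs \<in> set_pmf (srw_path E p n)"
  shows "xs \<in> range (history n)" "hd xs \<in> V"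
proof -
  have "xs \<in> range (history n) \<and> hd xs \<in> V"
    using assms(3)
  proof (induction n arbitrary: xs)
    case 0
    then show ?case
      using assms(1) by auto
  next
    case (Suc n)
    then obtain v ys where xs: "xs = v # ys" "ys \<in> set_pmf (srw_path E p n)"
        "v \<in> set_pmf (srw_step E (hd ys))"
      by auto
    from Suc.IH[OF xs(2)] obtain w where w: "ys = history n w" "w n \<in> V"
      by auto
    have "history n (w(Suc n := v)) = history n w"
      by (simp add: history_eq_iff)
    then have "xs = history (Suc n) (w(Suc n := v))"
      by (simp add: xs(1) w(1))
    then have "xs \<in> range (history (Suc n))"
      by blast
    then show ?case
      using assms(2)[OF w(2)] xs w by auto
  qed
  then show "xs \<in> range (history n)" "hd xs \<in> V"
    by auto
qed

lemma pmf_srw_path_history: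
  "ennreal (pmf (srw_path E p n) (history n w)) =
     indicator {p} (w 0) * (\<Prod>i<n. ennreal (pmf (srw_step E (w i)) (w (Suc i))))"
proof (induction n)
  case 0
  then show ?case
    by (auto simp: indicator_def)
next
  case (Suc n)
  let ?f = "\<lambda>xs. map_pmf (\<lambda>v. v # xs) (srw_step E (hd xs))"
  \<comment> \<open>A nonempty list determines its head and tail, so \<open>history n w\<close> is
    the only past that can lead to this history.\<close>
  have step: "ennreal (pmf (?f xs) (history (Suc n) w)) =
      ennreal (pmf (srw_step E (w n)) (w (Suc n))) * indicator {history n w} xs" for xs
  proof (cases "xs = history n w")
    case True
    have "pmf (?f xs) (w (Suc n) # xs) = pmf (srw_step E (hd xs)) (w (Suc n))"
      by (rule pmf_map_inj') (simp add: inj_def)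
    then show ?thesis
      by (simp add: True)
  next
    case False
    then have "pmf (?f xs) (history (Suc n) w) = 0"
      by (intro pmf_map_outside) auto
    then show ?thesis
      using False by simp
  qed
  have "ennreal (pmf (srw_path E p (Suc n)) (history (Suc n) w)) =
      ennreal (pmf (srw_step E (w n)) (w (Suc n))) * ennreal (pmf (srw_path E p n) (history n w))"
    unfolding srw_path.simps ennreal_pmf_bind step
    by (subst nn_integral_cmult_indicator) (simp_all add: emeasure_pmf_single)
  then show ?case
    by (simp add: Suc.IH mult_ac)
qed

text \<open>On a countable type singletons suffice. The preimage of a history is a cylinder, whose
  probability is the same product of step probabilities; a list that is no history of this length
  has mass zero on both sides.\<close>

lemma distr_history:
  fixes E :: "'a::countable \<Rightarrow> 'a \<Rightarrow> bool"
  shows "distr (srw E p) (count_space UNIV) (history n) = measure_pmf (srw_path E p n)"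
proof (rule measure_eqI_countable[where A = UNIV])
  have space: "space (srw E p) = UNIV"
    using sets_eq_imp_space_eq[OF sets_srw, of E p] by (simp add: space_PiM)
  fix xs :: "'a list"
  have *: "emeasure (distr (srw E p) (count_space UNIV) (history n)) {xs} =
      emeasure (srw E p) {\<omega>. history n \<omega> = xs}"
    by (subst emeasure_distr) (auto simp: space vimage_def measurable_history)
  show "emeasure (distr (srw E p) (count_space UNIV) (history n)) {xs} =
      emeasure (measure_pmf (srw_path E p n)) {xs}"
  proof (cases "xs \<in> range (history n)")
    case True
    then obtain w where xs: "xs = history n w"
      by auto
    show ?thesis
      unfolding * unfolding xs history_eq_iff emeasure_srw_cylinder emeasure_pmf_single
        pmf_srw_path_history ..
  next
    case False
    then have "{\<omega>. history n \<omega> = xs} = {}"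
      by auto
    moreover have "pmf (srw_path E p n) xs = 0"
      using set_srw_path(1)[of p UNIV E xs n] False by (auto simp: set_pmf_iff)
    ultimately show ?thesis
      by (simp add: * emeasure_pmf_single)
  qed
qed auto

section \<open>Expected hitting time as a sum of survival probabilities\<close>

lemma less_hitting_time_iff: "enat n < hitting_time q \<omega> \<longleftrightarrow> q \<notin> set (history n \<omega>)"
proof -
  have "enat n < hitting_time q \<omega> \<longleftrightarrow> (\<forall>m. \<omega> m = q \<longrightarrow> n < m)"
  proof
    assume "enat n < hitting_time q \<omega>"
    then show "\<forall>m. \<omega> m = q \<longrightarrow> n < m"
      unfolding hitting_time_def by (auto dest: less_INF_D)
  next
    assume *: "\<forall>m. \<omega> m = q \<longrightarrow> n < m"
    \<comment> \<open>An infimum inherits only non-strict lower bounds, hence the detour through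
      \<open>Suc n\<close>.\<close>
    have "enat (Suc n) \<le> hitting_time q \<omega>"
      unfolding hitting_time_def using * by (intro INF_greatest) auto
    then show "enat n < hitting_time q \<omega>"
      by (metis enat_ord_simps(2) lessI less_le_trans)
  qed
  then show ?thesis
    unfolding set_history by (auto simp: not_less)
qed

text \<open>The tail-sum formula: a time \<open>m\<close> in \<open>enat\<close> is the number of
  \<open>n\<close> with \<open>enat n < m\<close>, also when \<open>m\<close> is infinite, and
  nonnegative terms allow sum and integral to be exchanged.\<close>

lemma expected_hitting_time_eq_suminf:
  fixes E :: "'a::countable \<Rightarrow> 'a \<Rightarrow> bool"
  shows "expected_hitting_time E p q =
    (\<Sum>n. emeasure (measure_pmf (srw_path E p n)) {xs. q \<notin> set xs})"
proof -
  have space: "space (srw E p) = UNIV"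
    using sets_eq_imp_space_eq[OF sets_srw, of E p] by (simp add: space_PiM)
  have sum: "ennreal_of_enat m = (\<Sum>n. if enat n < m then 1 else 0)" for m
  proof (cases m)
    case (enat k)
    have "(\<Sum>n. if enat n < m then 1 else 0) = (\<Sum>n\<in>{..<k}. if enat n < m then 1 else (0::ennreal))"
      by (rule suminf_finite) (auto simp: enat)
    then show ?thesis
      by (simp add: enat ennreal_of_nat_eq_real_of_nat)
  next
    case infinity
    have "(\<Sum>n. 1 :: ennreal) = \<infinity>"
      by (simp add: suminf_eq_SUP ennreal_SUP_of_nat_eq_top)
    then show ?thesis
      by (simp add: infinity)
  qed
  have "expected_hitting_time E p q =
      (\<integral>\<^sup>+\<omega>. (\<Sum>n. indicator {xs. q \<notin> set xs} (history n \<omega>)) \<partial>srw E p)"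
    unfolding expected_hitting_time_def sum less_hitting_time_iff
    by (simp add: indicator_def of_bool_def)
  also have "\<dots> = (\<Sum>n. \<integral>\<^sup>+\<omega>. indicator {xs. q \<notin> set xs} (history n \<omega>) \<partial>srw E p)"
    by (intro nn_integral_suminf measurable_compose[OF measurable_history]) simp
  also have "(\<lambda>n. \<integral>\<^sup>+\<omega>. indicator {xs. q \<notin> set xs} (history n \<omega>) \<partial>srw E p) =
      (\<lambda>n. emeasure (measure_pmf (srw_path E p n)) {xs. q \<notin> set xs})"
  proof
    fix n
    have "(\<integral>\<^sup>+\<omega>. indicator {xs. q \<notin> set xs} (history n \<omega>) \<partial>srw E p) =
        (\<integral>\<^sup>+xs. indicator {xs. q \<notin> set xs} xs \<partial>distr (srw E p) (count_space UNIV) (history n))"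
      by (rule nn_integral_distr[symmetric]) (auto simp: measurable_history)
    then show "(\<integral>\<^sup>+\<omega>. indicator {xs. q \<notin> set xs} (history n \<omega>) \<partial>srw E p) =
        emeasure (measure_pmf (srw_path E p n)) {xs. q \<notin> set xs}"
      by (simp add: distr_history)
  qed
  finally show ?thesis .
qed

section \<open>The walk killed at the target\<close>

text \<open>Integral of \<open>f\<close> against the law of the \<open>n\<close>-th position of the walk killed at \<open>q\<close>.\<close>

definition killed_integral ::
    "('a \<Rightarrow> 'a \<Rightarrow> bool) \<Rightarrow> 'a \<Rightarrow> 'a \<Rightarrow> ('a \<Rightarrow> ennreal) \<Rightarrow> nat \<Rightarrow> ennreal" where
  "killed_integral E p q f n =
     (\<integral>\<^sup>+xs. f (hd xs) * indicator {xs. q \<notin> set xs} xs \<partial>srw_path E p n)"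

lemma killed_integral_0: "killed_integral E p q f 0 = f p * indicator (-{q}) p"
  by (auto simp: killed_integral_def indicator_def)

text \<open>The Markov property: an extended history avoids \<open>q\<close> iff the old one does
  and the new position is not \<open>q\<close>. Hence one more step amounts to applying the killed
  transition operator to \<open>f\<close>.\<close>

lemma killed_integral_Suc:
  "killed_integral E p q f (Suc n) =
     killed_integral E p q (\<lambda>u. \<integral>\<^sup>+v. f v * indicator (-{q}) v \<partial>srw_step E u) n"
proof -
  have "killed_integral E p q f (Suc n) =
      (\<integral>\<^sup>+xs. \<integral>\<^sup>+v. (f v * indicator (-{q}) v) * indicator {xs. q \<notin> set xs} xs
        \<partial>srw_step E (hd xs) \<partial>srw_path E p n)"
    unfolding killed_integral_def
    by (auto simp: measure_pmf_bind nn_integral_bind[where B = "count_space UNIV"]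
        measure_pmf_in_subprob_algebra indicator_def intro!: nn_integral_cong)
  then show ?thesis
    by (simp add: killed_integral_def nn_integral_multc)
qed

lemma killed_integral_add:
  "killed_integral E p q (\<lambda>u. f u + g u) n = killed_integral E p q f n + killed_integral E p q g n"
  unfolding killed_integral_def by (simp add: distrib_right nn_integral_add)

text \<open>A surviving history ends in \<open>V\<close> and away from \<open>q\<close>, so the
  comparison is needed only there.\<close>

lemma killed_integral_mono:
  assumes "p \<in> V" "\<And>u. u \<in> V \<Longrightarrow> set_pmf (srw_step E u) \<subseteq> V"
    and "\<And>u. u \<in> V \<Longrightarrow> u \<noteq> q \<Longrightarrow> f u \<le> g u"
  shows "killed_integral E p q f n \<le> killed_integral E p q g n"
  unfolding killed_integral_def
proof (rule nn_integral_mono_AE, unfold AE_measure_pmf_iff, rule ballI)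
  fix xs assume xs: "xs \<in> set_pmf (srw_path E p n)"
  from set_srw_path[OF assms(1,2) xs] have "hd xs \<in> set xs" "hd xs \<in> V"
    by (auto simp: set_history)
  then show "f (hd xs) * indicator {xs. q \<notin> set xs} xs \<le> g (hd xs) * indicator {xs. q \<notin> set xs} xs"
    using assms(3)[of "hd xs"] by (auto simp: indicator_def)
qed

lemma expected_hitting_time_eq_suminf_killed:
  fixes E :: "'a::countable \<Rightarrow> 'a \<Rightarrow> bool"
  shows "expected_hitting_time E p q = (\<Sum>n. killed_integral E p q (\<lambda>_. 1) n)"
  by (simp add: expected_hitting_time_eq_suminf killed_integral_def)

section \<open>Optional stopping bounds\<close>

text \<open>For a supersolution each step lowers the killed integral of \<open>f\<close> by at least
  the current survival probability. Telescoping bounds all partial sums of these probabilities by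
  \<open>f p\<close>.\<close>

lemma expected_hitting_time_le:
  fixes E :: "'a::countable \<Rightarrow> 'a \<Rightarrow> bool"
  assumes V: "p \<in> V" "\<And>u. u \<in> V \<Longrightarrow> set_pmf (srw_step E u) \<subseteq> V"
    and super: "\<And>u. u \<in> V \<Longrightarrow> u \<noteq> q \<Longrightarrow> (\<integral>\<^sup>+v. f v \<partial>srw_step E u) + 1 \<le> f u"
  shows "expected_hitting_time E p q \<le> f p"
proof -
  let ?K = "killed_integral E p q"
  have step: "?K f (Suc n) + ?K (\<lambda>_. 1) n \<le> ?K f n" for n
    unfolding killed_integral_Suc killed_integral_add[symmetric]
  proof (rule killed_integral_mono[OF V])
    fix u assume u: "u \<in> V" "u \<noteq> q"
    have "(\<integral>\<^sup>+v. f v * indicator (-{q}) v \<partial>srw_step E u) \<le> (\<integral>\<^sup>+v. f v \<partial>srw_step E u)"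
      by (intro nn_integral_mono) (auto simp: indicator_def)
    then show "(\<integral>\<^sup>+v. f v * indicator (-{q}) v \<partial>srw_step E u) + 1 \<le> f u"
      using super[OF u] by (meson add_right_mono order_trans)
  qed
  have "?K f n + (\<Sum>k<n. ?K (\<lambda>_. 1) k) \<le> f p" for n
  proof (induction n)
    case 0
    then show ?case
      by (simp add: killed_integral_0 indicator_def)
  next
    case (Suc n)
    have "?K f (Suc n) + (\<Sum>k<Suc n. ?K (\<lambda>_. 1) k) =
        (?K f (Suc n) + ?K (\<lambda>_. 1) n) + (\<Sum>k<n. ?K (\<lambda>_. 1) k)"
      by (simp add: ac_simps)
    also have "\<dots> \<le> f p"
      using add_right_mono[OF step] Suc.IH by (rule order_trans)
    finally show ?case .
  qed
  then have "(\<Sum>k<n. ?K (\<lambda>_. 1) k) \<le> f p" for n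
    by (meson add_increasing order_refl order_trans zero_le)
  then show ?thesis
    unfolding expected_hitting_time_eq_suminf_killed suminf_eq_SUP by (rule SUP_least)
qed

text \<open>The telescoping now runs the other way and leaves a remainder, the killed integral of
  \<open>f\<close> at time \<open>n\<close>. It is at most \<open>C\<close> times the survival
  probability, which vanishes in the limit if the expectation is finite; otherwise the bound is
  trivial.\<close>

lemma expected_hitting_time_ge:
  fixes E :: "'a::countable \<Rightarrow> 'a \<Rightarrow> bool"
  assumes V: "p \<in> V" "\<And>u. u \<in> V \<Longrightarrow> set_pmf (srw_step E u) \<subseteq> V"
    and sub: "\<And>u. u \<in> V \<Longrightarrow> u \<noteq> q \<Longrightarrow> f u \<le> (\<integral>\<^sup>+v. f v \<partial>srw_step E u) + 1"
    and "f q = 0"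
    and bound: "\<And>u. u \<in> V \<Longrightarrow> f u \<le> C" "C < \<infinity>"
  shows "f p \<le> expected_hitting_time E p q"
proof (cases "expected_hitting_time E p q = \<infinity>")
  case False
  let ?K = "killed_integral E p q"
  let ?S = "\<lambda>n. ?K (\<lambda>_. 1) n"
  \<comment> \<open>As \<open>f\<close> vanishes at the target, killing does not change its one-step
    average.\<close>
  have f: "f v * indicator (-{q}) v = f v" for v
    using assms(4) by (auto simp: indicator_def)
  have step: "?K f n \<le> ?K f (Suc n) + ?S n" for n
    unfolding killed_integral_Suc killed_integral_add[symmetric] f
    by (rule killed_integral_mono[OF V sub])
  have bnd: "?K f n \<le> C * ?S n" for n
  proof -
    have "?K f n \<le> ?K (\<lambda>_. C) n"
      by (rule killed_integral_mono[OF V bound(1)])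
    then show ?thesis
      by (simp add: killed_integral_def nn_integral_cmult)
  qed
  have "f p \<le> ?K f n + (\<Sum>k<n. ?S k)" for n
  proof (induction n)
    case 0
    then show ?case
      by (simp add: killed_integral_0 f)
  next
    case (Suc n)
    have "f p \<le> (?K f (Suc n) + ?S n) + (\<Sum>k<n. ?S k)"
      using Suc.IH add_right_mono[OF step] by (rule order_trans)
    then show ?case
      by (simp add: ac_simps)
  qed
  then have le: "f p \<le> C * ?S n + (\<Sum>k<n. ?S k)" for n
    using add_right_mono[OF bnd] by (rule order_trans)
  \<comment> \<open>A finite expectation makes the survival probabilities a summable real sequence,
    so they tend to zero.\<close>
  have fin: "(\<Sum>n. ?S n) \<noteq> \<infinity>"
    using False by (simp add: expected_hitting_time_eq_suminf_killed)
  have "?S n \<noteq> \<infinity>" for n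
    using fin by (metis ennreal_suminf_lessD infinity_ennreal_def less_top)
  then have real: "?S n = ennreal (enn2real (?S n))" for n
    by (simp add: less_top)
  have "summable (\<lambda>n. enn2real (?S n))"
    using fin real by (intro summable_suminf_not_top) (auto simp flip: real)
  then have "(\<lambda>n. ennreal (enn2real (?S n))) \<longlonglongrightarrow> ennreal 0"
    by (intro tendsto_ennrealI summable_LIMSEQ_zero)
  then have "?S \<longlonglongrightarrow> 0"
    by (simp flip: real)
  then have "(\<lambda>n. C * ?S n) \<longlonglongrightarrow> C * 0"
    using bound(2) by (intro ennreal_tendsto_cmult) auto
  moreover have "(\<lambda>n. \<Sum>k<n. ?S k) \<longlonglongrightarrow> (\<Sum>k. ?S k)"
    by (intro summable_LIMSEQ) simp
  ultimately have "(\<lambda>n. C * ?S n + (\<Sum>k<n. ?S k)) \<longlonglongrightarrow> C * 0 + (\<Sum>k. ?S k)"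
    by (rule tendsto_add)
  then have "f p \<le> C * 0 + (\<Sum>k. ?S k)"
    by (rule LIMSEQ_le_const) (use le in auto)
  then show ?thesis
    by (simp add: expected_hitting_time_eq_suminf_killed)
qed simp

section \<open>Quadratic bounds on the square of the cycle\<close>

lemma neighbours_cycle_square:
  assumes "u \<in> {0..<N}"
  shows "neighbours (cycle_square N) u = (\<lambda>d. (u - d) mod N) ` {1, -1, 2, -2}"
proof (intro set_eqI iffI)
  fix v assume "v \<in> neighbours (cycle_square N) u"
  then obtain d where d: "d \<in> {1, -1, 2, -2}" "[u - v = d] (mod N)" and v: "v \<in> {0..<N}"
    by (auto simp: neighbours_def cycle_square_def)
  from d(2) have "(u - d) mod N = v mod N"
    by (simp add: cong_def mod_eq_dvd_iff algebra_simps)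
  with v d(1) show "v \<in> (\<lambda>d. (u - d) mod N) ` {1, -1, 2, -2}"
    by (intro image_eqI[of _ _ d]) auto
next
  fix v assume "v \<in> (\<lambda>d. (u - d) mod N) ` {1, -1, 2, -2}"
  then obtain d where d: "d \<in> {1, -1, 2, -2}" and v: "v = (u - d) mod N"
    by blast
  have "[u - v = d] (mod N)"
    unfolding v cong_def by (simp add: mod_diff_right_eq)
  with d assms v show "v \<in> neighbours (cycle_square N) u"
    by (auto simp: neighbours_def cycle_square_def)
qed

text \<open>Averages over neighbours become averages over the four displacements. Writing the
  integrand through the residue of \<open>v - l\<close> reduces the step to one from the position
  relative to the target.\<close>

lemma
  assumes "N \<ge> 5" "u \<in> {0..<N}"
  shows set_srw_step_cycle_square: "set_pmf (srw_step (cycle_square N) u) \<subseteq> {0..<N}"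
    and nn_integral_srw_step_cycle_square: "(\<And>j. 0 \<le> j \<Longrightarrow> j < N \<Longrightarrow> 0 \<le> F j) \<Longrightarrow>
      (\<integral>\<^sup>+v. ennreal (F ((v - l) mod N)) \<partial>srw_step (cycle_square N) u) =
      ennreal ((\<Sum>d\<in>{1, -1, 2, -2}. F (((u - l) mod N - d) mod N)) / 4)"
proof -
  let ?D = "{1, -1, 2, -2 :: int}" and ?S = "neighbours (cycle_square N) u"
  have S: "?S = (\<lambda>d. (u - d) mod N) ` ?D"
    by (rule neighbours_cycle_square[OF assms(2)])
  have card: "card ?S = 4"
    by (rule card_neighbours_cycle_square[OF assms])
  then have fin: "finite ?S" "?S \<noteq> {}"
    using card.infinite by fastforce+
  \<comment> \<open>Four displacements have an image of four elements, so no two of them lead to the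
    same vertex.\<close>
  have inj: "inj_on (\<lambda>d. (u - d) mod N) ?D"
    using card unfolding S by (intro eq_card_imp_inj_on) auto
  show "set_pmf (srw_step (cycle_square N) u) \<subseteq> {0..<N}"
    unfolding srw_step_def using fin by (auto simp: neighbours_def cycle_square_def)
  assume F: "\<And>j. 0 \<le> j \<Longrightarrow> j < N \<Longrightarrow> 0 \<le> F j"
  have "(\<integral>\<^sup>+v. ennreal (F ((v - l) mod N)) \<partial>srw_step (cycle_square N) u) =
      (\<Sum>v\<in>?S. ennreal (F ((v - l) mod N))) / 4"
    unfolding srw_step_def using fin by (simp add: nn_integral_pmf_of_set card)
  also have "(\<Sum>v\<in>?S. ennreal (F ((v - l) mod N))) =
      (\<Sum>d\<in>?D. ennreal (F (((u - d) mod N - l) mod N)))"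
    unfolding S by (subst sum.reindex[OF inj]) (simp only: o_def)
  also have "\<dots> = (\<Sum>d\<in>?D. ennreal (F (((u - l) mod N - d) mod N)))"
    by (intro sum.cong refl) (simp add: mod_diff_left_eq algebra_simps)
  also have "\<dots> = ennreal (\<Sum>d\<in>?D. F (((u - l) mod N - d) mod N))"
    using F assms(1) by (intro sum_ennreal) simp
  also have "\<dots> / 4 = ennreal ((\<Sum>d\<in>?D. F (((u - l) mod N - d) mod N)) / 4)"
    using divide_ennreal[of "\<Sum>d\<in>?D. F (((u - l) mod N - d) mod N)" 4] F assms(1)
    by (simp add: sum_nonneg del: sum.insert)
  finally show "(\<integral>\<^sup>+v. ennreal (F ((v - l) mod N)) \<partial>srw_step (cycle_square N) u) =
      ennreal ((\<Sum>d\<in>?D. F (((u - l) mod N - d) mod N)) / 4)" .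
qed

section \<open>The quadratic function and its one-step average\<close>

text \<open>The displacements have mean square (1 + 1 + 4 + 4) / 4 = 5/2, so away from wrapping the
  average of d (N - d) drops by 5/2 in a step; the factor 2/5 normalises this to 1.\<close>

definition quadratic :: "int \<Rightarrow> int \<Rightarrow> real" where
  "quadratic N d = 2 / 5 * of_int d * (of_int N - of_int d)"

lemma quadratic_nonneg: "0 \<le> d \<Longrightarrow> d \<le> N \<Longrightarrow> 0 \<le> quadratic N d"
  by (simp add: quadratic_def)

text \<open>Opposite displacements cancel the linear terms. At \<open>d = 1\<close> one step leads
  to -1, which wraps to \<open>N - 1\<close>; there the value exceeds the polynomial at -1 by 4/5 N,
  which adds N/5 to the average. The case \<open>d = N - 1\<close> is its mirror image.\<close>

lemma quadratic_average:
  assumes "N \<ge> 5" "0 < d" "d < N"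
  shows "(\<Sum>e\<in>{1, -1, 2, -2}. quadratic N ((d - e) mod N)) / 4 =
    quadratic N d - 1 + (if d = 1 \<or> d = N - 1 then of_int N / 5 else 0)"
proof -
  \<comment> \<open>Wrapping from \<open>N\<close> to 0 is harmless because the polynomial vanishes
    at both.\<close>
  have mod: "quadratic N (j mod N) = quadratic N j" if "0 \<le> j" "j \<le> N" for j
    using that by (cases "j = N") (auto simp: quadratic_def)
  consider "d = 1" | "N = d + 1" | "2 \<le> d" "d \<le> N - 2"
    using assms by linarith
  then show ?thesis
  proof cases
    case 1
    have *: "(- 1) mod N = N - 1"
      using assms by (simp add: zmod_minus1)
    show ?thesis
      using assms 1 mod[of 0] mod[of 2] mod[of 3] by (simp add: * quadratic_def field_simps)
  next
    case 2
    have "(d - 1) mod N = d - 1" "(d - 2) mod N = d - 2" "(d + 1) mod N = 0"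
      using assms 2 by (auto intro: mod_pos_pos_trivial)
    moreover have "(d + 2) mod N = 1"
      using assms 2 mod_add_self2[of 1 N] by (simp add: add.commute)
    ultimately have "(\<Sum>e\<in>{1, -1, 2, -2}. quadratic N ((d - e) mod N)) =
        quadratic N (d - 1) + quadratic N 0 + quadratic N (d - 2) + quadratic N 1"
      by simp
    then show ?thesis
      using assms by (simp add: 2 quadratic_def field_simps)
  next
    case 3
    then have "d \<noteq> 1 \<and> d \<noteq> N - 1"
      by auto
    then show ?thesis
      using assms 3 mod[of "d - 1"] mod[of "d + 1"] mod[of "d - 2"] mod[of "d + 2"]
      by (simp add: quadratic_def field_simps)
  qed
qed

lemma diff_mod_pos:
  fixes u l N :: int
  assumes "u \<in> {0..<N}" "l \<in> {0..<N}" "u \<noteq> l"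
  shows "0 < (u - l) mod N"
proof -
  have "\<not> N dvd u - l"
    using assms dvd_imp_le_int[of "u - l" N] by auto
  then have "(u - l) mod N \<noteq> 0"
    by (simp add: mod_eq_0_iff_dvd)
  then show ?thesis
    using assms by (simp add: less_le)
qed

text \<open>The start 0 lies at residue \<open>- l\<close> from the target; the symmetry under
  exchanging d and N - d turns its value into that at \<open>l\<close>.\<close>

lemma quadratic_minus_mod:
  assumes "0 \<le> l" "l < N"
  shows "quadratic N ((- l) mod N) = quadratic N l"
  using assms by (cases "l = 0") (auto simp: quadratic_def zmod_zminus1_eq_if)

section \<open>Two-sided bounds on the expected hitting time\<close>

text \<open>The excess N/5 is nonnegative, so the quadratic is a subsolution. It vanishes at the
  target, and its maximum over the finitely many vertices serves as the bound
  \<open>C\<close>.\<close>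

lemma h_sq_ge:
  assumes "N \<ge> 5" "0 \<le> l" "l < N"
  shows "ennreal (quadratic N l) \<le> h_sq N 0 l"
proof -
  let ?f = "\<lambda>u. ennreal (quadratic N ((u - l) mod N))"
  have "?f 0 \<le> expected_hitting_time (cycle_square N) 0 l"
  proof (rule expected_hitting_time_ge[where V = "{0..<N}" and C = "Max (?f ` {0..<N})"])
    fix u assume u: "u \<in> {0..<N}" "u \<noteq> l"
    define d where "d = (u - l) mod N"
    have d: "0 < d" "d < N"
      using assms u diff_mod_pos[of u N l] by (auto simp: d_def)
    define A where "A = (\<Sum>e\<in>{1, -1, 2, -2}. quadratic N ((d - e) mod N)) / 4"
    have A: "0 \<le> A"
      unfolding A_def using assms by (intro divide_nonneg_nonneg sum_nonneg quadratic_nonneg) (auto simp: less_imp_le)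
    have *: "(\<integral>\<^sup>+v. ?f v \<partial>srw_step (cycle_square N) u) = ennreal A"
      unfolding A_def d_def
      by (intro nn_integral_srw_step_cycle_square assms u quadratic_nonneg) auto
    have "quadratic N d \<le> A + 1"
      unfolding A_def quadratic_average[OF assms(1) d] using assms by simp
    then show "?f u \<le> (\<integral>\<^sup>+v. ?f v \<partial>srw_step (cycle_square N) u) + 1"
      unfolding * d_def[symmetric] using A
      by (simp add: ennreal_1[symmetric] ennreal_plus[symmetric] ennreal_leI del: ennreal_1 ennreal_plus)
  next
    show "Max (?f ` {0..<N}) < \<infinity>"
      using assms by (subst Max_less_iff) auto
  next
    show "?f u \<le> Max (?f ` {0..<N})" if "u \<in> {0..<N}" for u
      using that by (intro Max_ge) auto
  qed (use assms set_srw_step_cycle_square in \<open>auto simp: quadratic_def\<close>)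
  then show ?thesis
    by (simp add: h_sq_def quadratic_minus_mod assms)
qed

text \<open>The constant pays for the excess \<open>N / 5\<close> because positions \<open>1\<close> and \<open>N - 1\<close> have the
  target among their four neighbours.\<close>

lemma h_sq_le:
  assumes "N \<ge> 5" "0 \<le> l" "l < N"
  shows "h_sq N 0 l \<le> ennreal (quadratic N l + 4 / 5 * of_int N)"
proof -
  define F where "F j = quadratic N j + (if j = 0 then 0 else 4 / 5 * of_int N)" for j
  have F: "0 \<le> F j" if "0 \<le> j" "j < N" for j
    using that by (simp add: F_def quadratic_nonneg)
  let ?f = "\<lambda>u. ennreal (F ((u - l) mod N))"
  have "expected_hitting_time (cycle_square N) 0 l \<le> ?f 0"
  proof (rule expected_hitting_time_le[where V = "{0..<N}"])
    fix u assume u: "u \<in> {0..<N}" "u \<noteq> l"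
    define d where "d = (u - l) mod N"
    have d: "0 < d" "d < N"
      using assms u diff_mod_pos[of u N l] by (auto simp: d_def)
    let ?D = "{1, -1, 2, -2} :: int set"
    define A where "A = (\<Sum>e\<in>?D. F ((d - e) mod N)) / 4"
    have A: "0 \<le> A"
      unfolding A_def using assms by (intro divide_nonneg_nonneg sum_nonneg F) auto
    have *: "(\<integral>\<^sup>+v. ?f v \<partial>srw_step (cycle_square N) u) = ennreal A"
      unfolding A_def d_def by (intro nn_integral_srw_step_cycle_square assms u F) auto
    \<comment> \<open>One target among the four neighbours removes a quarter of 4/5 N from the
      average, exactly the excess N/5. Only an inequality holds in general, since positions 2 and
      \<open>N - 2\<close> also neighbour the target.\<close>
    have "(\<Sum>e\<in>?D. if (d - e) mod N = 0 then 0 else 4 / 5 * of_int N) \<le>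
        (\<Sum>e\<in>?D. 4 / 5 * real_of_int N) - (if d = 1 \<or> d = N - 1 then 4 / 5 * of_int N else 0)"
      using assms by auto
    then have "A + 1 \<le> F d"
      unfolding A_def F_def sum.distrib add_divide_distrib quadratic_average[OF assms(1) d]
      using d by (auto split: if_splits)
    then show "(\<integral>\<^sup>+v. ?f v \<partial>srw_step (cycle_square N) u) + 1 \<le> ?f u"
      unfolding * d_def[symmetric] using A
      by (simp add: ennreal_1[symmetric] ennreal_plus[symmetric] ennreal_leI del: ennreal_1 ennreal_plus)
  qed (use assms set_srw_step_cycle_square in auto)
  \<comment> \<open>For \<open>l = 0\<close> the walk starts at the target, where \<open>F\<close>
    omits the constant.\<close>
  also have "?f 0 \<le> ennreal (quadratic N l + 4 / 5 * of_int N)"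
    using assms by (intro ennreal_leI) (simp add: F_def quadratic_minus_mod)
  finally show ?thesis
    by (simp add: h_sq_def)
qed

section \<open>Passage to the limit\<close>

theorem theorem5p3:
  fixes x :: real and N l :: "nat \<Rightarrow> int"
  assumes "x \<in> {0..1}"
    and "\<And>k. N k \<ge> 5"
    and "\<And>k. 0 \<le> l k \<and> l k \<le> N k - 1"
    and "filterlim N at_top sequentially"
    and "(\<lambda>k. real_of_int (l k) / real_of_int (N k)) \<longlonglongrightarrow> x"
  shows "(\<lambda>k. h_sq (N k) 0 (l k) / ennreal (real_of_int (N k) ^ 2))
           \<longlonglongrightarrow> ennreal (2 / 5 * x * (1 - x))"
proof (rule tendsto_sandwich)
  let ?y = "\<lambda>k. real_of_int (l k) / real_of_int (N k)"
  have pos: "0 < real_of_int (N k)" for k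
    using assms(2)[of k] by simp
  have l: "0 \<le> l k" "l k < N k" for k
    using assms(3)[of k] by auto
  \<comment> \<open>The quadratic is homogeneous of degree two in position and \<open>N\<close>
    together, so after division it depends on the ratio alone.\<close>
  have q: "quadratic (N k) (l k) / real_of_int (N k) ^ 2 = 2 / 5 * ?y k * (1 - ?y k)" for k
    using pos[of k] by (simp add: quadratic_def power2_eq_square field_simps)
  have le: "ennreal a / ennreal (real_of_int (N k) ^ 2) = ennreal (a / real_of_int (N k) ^ 2)"
    if "0 \<le> a" for a k
    using that pos[of k] by (intro divide_ennreal) auto
  have nn: "0 \<le> quadratic (N k) (l k)" for k
    using l[of k] by (intro quadratic_nonneg) auto
  show "\<forall>\<^sub>F k in sequentially.
      ennreal (2 / 5 * ?y k * (1 - ?y k)) \<le> h_sq (N k) 0 (l k) / ennreal (real_of_int (N k) ^ 2)"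
    using divide_right_mono_ennreal[OF h_sq_ge[OF assms(2) l]]
    by (metis (no_types, lifting) always_eventually le nn q)
  \<comment> \<open>The correction is only linear in \<open>N k\<close>, so division by the square
    leaves a multiple of 1 / N, which tends to zero.\<close>
  have "(quadratic (N k) (l k) + 4 / 5 * of_int (N k)) / real_of_int (N k) ^ 2 =
      2 / 5 * ?y k * (1 - ?y k) + 4 / 5 * inverse (real_of_int (N k))" for k
    unfolding add_divide_distrib q using pos[of k] by (simp add: power2_eq_square field_simps)
  moreover have "0 \<le> quadratic (N k) (l k) + 4 / 5 * of_int (N k)" for k
    using nn[of k] pos[of k] by simp
  ultimately show "\<forall>\<^sub>F k in sequentially. h_sq (N k) 0 (l k) / ennreal (real_of_int (N k) ^ 2) \<le>
      ennreal (2 / 5 * ?y k * (1 - ?y k) + 4 / 5 * inverse (real_of_int (N k)))"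
    using divide_right_mono_ennreal[OF h_sq_le[OF assms(2) l]]
    by (metis (no_types, lifting) always_eventually le)
  have inv: "(\<lambda>k. inverse (real_of_int (N k))) \<longlonglongrightarrow> 0"
    using assms(4)
    by (intro tendsto_inverse_0_at_top filterlim_compose[OF filterlim_real_of_int_at_top])
  show "(\<lambda>k. ennreal (2 / 5 * ?y k * (1 - ?y k))) \<longlonglongrightarrow> ennreal (2 / 5 * x * (1 - x))"
    by (intro tendsto_ennrealI tendsto_intros assms(5))
  have "(\<lambda>k. 2 / 5 * ?y k * (1 - ?y k) + 4 / 5 * inverse (real_of_int (N k))) \<longlonglongrightarrow>
      2 / 5 * x * (1 - x) + 4 / 5 * 0"
    by (intro tendsto_intros assms(5) inv)
  then show "(\<lambda>k. ennreal (2 / 5 * ?y k * (1 - ?y k) + 4 / 5 * inverse (real_of_int (N k))))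
      \<longlonglongrightarrow> ennreal (2 / 5 * x * (1 - x))"
    by (intro tendsto_ennrealI) simp
qed

end
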